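(* Let $\mathcal{Y}$ be a finite set and $h:\Delta_{\mathcal{Y}}\to\mathbb{R}$ a continuous concave function. For every $\varepsilon>0$ there is a number $n=n_\varepsilon$, depending only on $\varepsilon$ and the function $h$, with the following property. For every two-point representation $$\left(\{\beta_0(u)T_0(z^j,u)\}_{j\le k},\ \{\beta_1(v)T_1(z^j,v)\}_{j\le k}\right)$$ with total weights $w_u,w_v$ (for any $k$, any group proportions $\alpha_0,\alpha_1$, and any conditional distributions $\rho_u,\rho_v\in\Delta_{\mathcal{Y}}$), there is a two-point representation $T'$ on a set $\mathcal{Z}'_{uv}$, with the same total weights (and the same $\alpha_0,\alpha_1,\rho_u,\rho_v$), such that $|\mathcal{Z}'_{uv}|\le n$ and $$F_{uv,T'}\le F_{uv,T}\quad\text{and}\quad E_{uv,T'}\le E_{uv,T}+2(w_u+w_v)\varepsilon .$$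
   Context: $\Delta_{\mathcal{Y}}$ is the set of probability distributions on $\mathcal{Y}$. Data model: $S_0,S_1$ are finite disjoint sets, $S=S_0\cup S_1$ carries a probability distribution $\zeta$, $X$ takes values in $S$ with $\mathbb{P}(X=s)=\zeta(s)$, and $A=\mathbf{1}\{X\in S_1\}$. The variable $Y\in\mathcal{Y}$ has conditional distribution $\rho_s\in\Delta_{\mathcal{Y}}$ given $X=s$. For $a\in\{0,1\}$, $\alpha_a=\mathbb{P}(A=a)>0$ (so $\alpha_0+\alpha_1=1$) and $\beta_a(s)=\mathbb{P}(X=s\mid A=a)$. A representation $T$ on a finite set $\mathcal{Z}$ is given by transition kernels $T_a(z,s)=\mathbb{P}(Z=z\mid X=s,A=a)$, $s\in S_a$. A point $s\in S_a$ is a parent of $z$ if $T_a(z,s)>0$; $T$ is invertible if each $z\in\mathcal{Z}$ has at most one parent in $S_0$ and at most one parent in $S_1$. Two-point representation: for an invertible representation $T$ and points $u\in S_0$, $v\in S_1$, let $\mathcal{Z}_{uv}=\{z^1,\dots,z^k\}$ be the set of all $z\in\mathcal{Z}$ which have $u$ and $v$ as parents. The collection of numbers $\left(\{\beta_0(u)T_0(z^j,u)\}_{j\le k},\{\beta_1(v)T_1(z^j,v)\}_{j\le k}\right)$ is called a two-point representation (considered independently of the rest of the representation; it describes how weight from $u$ and $v$ is distributed over the points of $\mathcal{Z}_{uv}$). Its total weights are $$w_u=\sum_{j=1}^k\beta_0(u)T_0(z^j,u),\qquad w_v=\sum_{j=1}^k\beta_1(v)T_1(z^j,v).$$ Its performance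 cost contribution is $$E_{uv,T}=\sum_{j\le k}\left(\alpha_0\beta_0(u)T_0(z^j,u)+\alpha_1\beta_1(v)T_1(z^j,v)\right)h\left(\frac{\alpha_0\beta_0(u)T_0(z^j,u)\rho_u+\alpha_1\beta_1(v)T_1(z^j,v)\rho_v}{\alpha_0\beta_0(u)T_0(z^j,u)+\alpha_1\beta_1(v)T_1(z^j,v)}\right)$$ (a term with zero total weight counts as $0$), and its fairness contribution is $$F_{uv,T}=\frac12\sum_{j\le k}\left|\beta_0(u)T_0(z^j,u)-\beta_1(v)T_1(z^j,v)\right|.$$ *)

theory Defs
  imports "HOL-Analysis.Analysis" "HOL-Probability.Probability"
begin

(* The distributions on the finite set 'y, as a subset of Euclidean space, so that continuity
   and concavity of functions on it are the library notions. *)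
definition prob_simplex :: "(real ^ 'y) set" where
  "prob_simplex = {\<rho>. (\<forall>y. 0 \<le> \<rho> $ y) \<and> (\<Sum>y\<in>UNIV. \<rho> $ y) = 1}"

(* S0 and S1 are the two groups, \<zeta> is the law of X, and \<rho> s is the conditional law of Y
   given X = s. The variable A is the indicator of the event that X lies in S1. *)
definition data_model ::
  "'s set \<Rightarrow> 's set \<Rightarrow> 's pmf \<Rightarrow> ('s \<Rightarrow> real ^ 'y) \<Rightarrow> bool" where
  "data_model S0 S1 \<zeta> \<rho> \<longleftrightarrow>
     finite S0 \<and> finite S1 \<and> S0 \<inter> S1 = {} \<and> set_pmf \<zeta> \<subseteq> S0 \<union> S1 \<and>
     \<P>(x in measure_pmf \<zeta>. x \<in> S0) > 0 \<and> \<P>(x in measure_pmf \<zeta>. x \<in> S1) > 0 \<and>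
     (\<forall>s\<in>S0 \<union> S1. \<rho> s \<in> prob_simplex)"

(* The group proportion P(A = a) and the conditional weight P(X = s | A = a), for Sa the group
   of index a. *)
definition group_proportion :: "'s pmf \<Rightarrow> 's set \<Rightarrow> real" where
  "group_proportion \<zeta> Sa = \<P>(x in measure_pmf \<zeta>. x \<in> Sa)"

definition group_weight :: "'s pmf \<Rightarrow> 's set \<Rightarrow> 's \<Rightarrow> real" where
  "group_weight \<zeta> Sa s = \<P>(x in measure_pmf \<zeta>. x = s \<bar> x \<in> Sa)"

(* The kernel value written T_a(z,s) on paper is pmf (Ta s) z; only s in the group Sa matters. *)
definition representation ::
  "'s set \<Rightarrow> 's set \<Rightarrow> 'z set \<Rightarrow> ('s \<Rightarrow> 'z pmf) \<Rightarrow> ('s \<Rightarrow> 'z pmf) \<Rightarrow> bool" where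
  "representation S0 S1 Z T0 T1 \<longleftrightarrow>
     finite Z \<and> (\<forall>s\<in>S0. set_pmf (T0 s) \<subseteq> Z) \<and> (\<forall>s\<in>S1. set_pmf (T1 s) \<subseteq> Z)"

definition is_parent :: "'s set \<Rightarrow> ('s \<Rightarrow> 'z pmf) \<Rightarrow> 's \<Rightarrow> 'z \<Rightarrow> bool" where
  "is_parent Sa Ta s z \<longleftrightarrow> s \<in> Sa \<and> pmf (Ta s) z > 0"

definition invertible_representation ::
  "'s set \<Rightarrow> 's set \<Rightarrow> 'z set \<Rightarrow> ('s \<Rightarrow> 'z pmf) \<Rightarrow> ('s \<Rightarrow> 'z pmf) \<Rightarrow> bool" where
  "invertible_representation S0 S1 Z T0 T1 \<longleftrightarrow>
     representation S0 S1 Z T0 T1 \<and>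
     (\<forall>z\<in>Z. (\<forall>s s'. is_parent S0 T0 s z \<and> is_parent S0 T0 s' z \<longrightarrow> s = s') \<and>
            (\<forall>s s'. is_parent S1 T1 s z \<and> is_parent S1 T1 s' z \<longrightarrow> s = s'))"

(* A two-point representation is the pair of families p, q on the finite index set Zuv that some
   invertible representation induces at some points u, v; the values of p, q off Zuv are
   irrelevant. The ambient data model is quantified away, keeping only the group proportions and
   the conditional distributions at u and v. Points of the groups are coded as natural numbers,
   which is no restriction because the groups are finite. *)
definition two_point_representation ::
  "real \<Rightarrow> real \<Rightarrow> real ^ 'y \<Rightarrow> real ^ 'y \<Rightarrow> 'z set \<Rightarrow> ('z \<Rightarrow> real) \<Rightarrow> ('z \<Rightarrow> real) \<Rightarrow> bool" where
  "two_point_representation \<alpha>0 \<alpha>1 \<rho>u \<rho>v Zuv p q \<longleftrightarrow>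
     (\<exists>(S0 :: nat set) S1 \<zeta> \<rho> Z T0 T1 u v.
        data_model S0 S1 \<zeta> \<rho> \<and> invertible_representation S0 S1 Z T0 T1 \<and>
        u \<in> S0 \<and> v \<in> S1 \<and>
        \<alpha>0 = group_proportion \<zeta> S0 \<and> \<alpha>1 = group_proportion \<zeta> S1 \<and>
        \<rho>u = \<rho> u \<and> \<rho>v = \<rho> v \<and>
        Zuv = {z \<in> Z. is_parent S0 T0 u z \<and> is_parent S1 T1 v z} \<and>
        (\<forall>z\<in>Zuv. p z = group_weight \<zeta> S0 u * pmf (T0 u) z \<and>
                 q z = group_weight \<zeta> S1 v * pmf (T1 v) z))"

definition total_weight :: "'z set \<Rightarrow> ('z \<Rightarrow> real) \<Rightarrow> real" where
  "total_weight Zuv p = (\<Sum>z\<in>Zuv. p z)"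

(* A term with zero total weight is 0 whatever value h takes at the junk argument. *)
definition perf_cost ::
  "(real ^ 'y \<Rightarrow> real) \<Rightarrow> real \<Rightarrow> real \<Rightarrow> real ^ 'y \<Rightarrow> real ^ 'y \<Rightarrow>
   'z set \<Rightarrow> ('z \<Rightarrow> real) \<Rightarrow> ('z \<Rightarrow> real) \<Rightarrow> real" where
  "perf_cost h \<alpha>0 \<alpha>1 \<rho>u \<rho>v Zuv p q =
     (\<Sum>z\<in>Zuv. (\<alpha>0 * p z + \<alpha>1 * q z) *
        h (((\<alpha>0 * p z) *\<^sub>R \<rho>u + (\<alpha>1 * q z) *\<^sub>R \<rho>v) /\<^sub>R (\<alpha>0 * p z + \<alpha>1 * q z)))"

definition fairness :: "'z set \<Rightarrow> ('z \<Rightarrow> real) \<Rightarrow> ('z \<Rightarrow> real) \<Rightarrow> real" where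
  "fairness Zuv p q = 1 / 2 * (\<Sum>z\<in>Zuv. \<bar>p z - q z\<bar>)"

end

(* Merge all points z whose mixture parameter t(z) = a0 p(z) / (a0 p(z) + a1 q(z)) lies in the same
   of boundedly many short intervals, adding up their weights. By the triangle inequality this can
   only decrease the fairness contribution. The parameter of a merged point is a weighted average
   of the old ones, hence stays in the same interval, so uniform continuity of h bounds the increase
   of the performance cost. *)
theory Submission
  imports Defs
begin

section \<open>Uniform continuity of \<open>h\<close> along segments of the simplex\<close>

lemma compact_prob_simplex: "compact (prob_simplex :: (real ^ 'y) set)"
proof -
  have "norm x \<le> 1" if "x \<in> prob_simplex" for x :: "real ^ 'y"
  proof -
    have "norm x \<le> (\<Sum>y\<in>UNIV. \<bar>x $ y\<bar>)" by (rule norm_le_l1_cart)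
    also have "\<dots> = 1" using that by (simp add: prob_simplex_def)
    finally show ?thesis .
  qed
  then have "bounded (prob_simplex :: (real ^ 'y) set)" by (auto intro: boundedI)
  moreover have "closed (prob_simplex :: (real ^ 'y) set)"
    unfolding prob_simplex_def
    by (intro closed_Collect_conj closed_Collect_all closed_Collect_le closed_Collect_eq
        continuous_intros)
  ultimately show ?thesis by (simp add: compact_eq_bounded_closed)
qed

lemma convex_prob_simplex: "convex (prob_simplex :: (real ^ 'y) set)"
  by (rule convexI) (simp add: prob_simplex_def sum.distrib flip: sum_distrib_left)

text \<open>Mixtures of \<open>a\<close> and \<open>b\<close> with parameters \<open>s\<close> and
  \<open>t\<close> differ by \<open>(s - t)\<close> times \<open>a - b\<close>, and the differences
  \<open>a - b\<close> are bounded on a compact set. One mesh \<open>1 / N\<close> thus serves all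
  endpoints at once, which is what later makes the bound on the number of points independent of
  \<rho>u and \<rho>v.\<close>

lemma mixture_modulus:
  fixes h :: "'a::real_normed_vector \<Rightarrow> real"
  assumes "compact K" "convex K" "continuous_on K h" "\<epsilon> > 0"
  obtains N :: nat where "N > 0"
    and "\<And>a b s t. \<lbrakk>a \<in> K; b \<in> K; s \<in> {0..1}; t \<in> {0..1}; \<bar>s - t\<bar> \<le> 1 / N\<rbrakk>
      \<Longrightarrow> \<bar>h (s *\<^sub>R a + (1 - s) *\<^sub>R b) - h (t *\<^sub>R a + (1 - t) *\<^sub>R b)\<bar> < \<epsilon>"
proof -
  have "uniformly_continuous_on K h" by (rule compact_uniformly_continuous) (use assms in auto)
  then obtain d where d: "d > 0"
    "\<And>x y. \<lbrakk>x \<in> K; y \<in> K; dist y x < d\<rbrakk> \<Longrightarrow> dist (h y) (h x) < \<epsilon>"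
    using \<open>\<epsilon> > 0\<close> unfolding uniformly_continuous_on_def by metis
  obtain D where D: "D > 0" "\<And>x. x \<in> K \<Longrightarrow> norm x \<le> D"
    using compact_imp_bounded[OF \<open>compact K\<close>] unfolding bounded_pos by auto
  \<comment> \<open>\<open>2 * D\<close> bounds the diameter of \<open>K\<close>, so a parameter
    change of at most \<open>1 / N\<close> moves the mixture by less than \<open>d\<close>.\<close>
  obtain N :: nat where N: "2 * D / d < N" using reals_Archimedean2 by blast
  with d(1) D(1) have "N > 0" by (auto intro!: Nat.gr0I simp: field_simps)
  show ?thesis
  proof (rule that[OF \<open>N > 0\<close>])
    fix a b s and t :: real
    assume *: "a \<in> K" "b \<in> K" "s \<in> {0..1}" "t \<in> {0..1}" "\<bar>s - t\<bar> \<le> 1 / N"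
    let ?x = "s *\<^sub>R a + (1 - s) *\<^sub>R b" and ?y = "t *\<^sub>R a + (1 - t) *\<^sub>R b"
    have "?x - ?y = (s - t) *\<^sub>R (a - b)" by (simp add: algebra_simps)
    then have "dist ?x ?y = \<bar>s - t\<bar> * norm (a - b)" by (simp add: dist_norm)
    also have "\<dots> \<le> 1 / N * (2 * D)"
      using * D(2)[of a] D(2)[of b] norm_triangle_ineq4[of a b] by (intro mult_mono) auto
    also have "\<dots> < d" using N d(1) \<open>N > 0\<close> by (simp add: field_simps)
    finally have "dist ?x ?y < d" .
    moreover have "?x \<in> K" "?y \<in> K" using * \<open>convex K\<close> by (auto intro!: convexD)
    ultimately show "\<bar>h ?x - h ?y\<bar> < \<epsilon>" using d(2) by (simp add: dist_real_def)
  qed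
qed

section \<open>Merging points along a labelling\<close>

definition fibre_sum :: "'z set \<Rightarrow> ('z \<Rightarrow> 'k) \<Rightarrow> ('z \<Rightarrow> real) \<Rightarrow> 'k \<Rightarrow> real" where
  "fibre_sum Z c p k = (\<Sum>z | z \<in> Z \<and> c z = k. p z)"

lemma sum_fibre_sum: "finite Z \<Longrightarrow> (\<Sum>k\<in>c ` Z. fibre_sum Z c p k) = sum p Z"
  unfolding fibre_sum_def by (rule sum.image_gen[symmetric])

text \<open>Fibres over the image are nonempty. Strict positivity matters because every point of a
  two-point representation must have both \<open>u\<close> and \<open>v\<close> as parents.\<close>

lemma fibre_sum_pos:
  assumes "finite Z" "\<And>z. z \<in> Z \<Longrightarrow> p z > 0" "k \<in> c ` Z"
  shows "fibre_sum Z c p k > 0"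
  unfolding fibre_sum_def using assms by (intro sum_pos) auto

text \<open>Differences \<open>p z - q z\<close> of opposite sign cancel inside a fibre, and the
  absolute values can only shrink.\<close>

lemma fairness_fibre_sum_le:
  assumes "finite Z"
  shows "fairness (c ` Z) (fibre_sum Z c p) (fibre_sum Z c q) \<le> fairness Z p q"
proof -
  have "(\<Sum>k\<in>c ` Z. \<bar>fibre_sum Z c p k - fibre_sum Z c q k\<bar>)
      \<le> (\<Sum>k\<in>c ` Z. fibre_sum Z c (\<lambda>z. \<bar>p z - q z\<bar>) k)"
    unfolding fibre_sum_def by (intro sum_mono) (simp add: sum_abs flip: sum_subtractf)
  then show ?thesis by (simp add: fairness_def sum_fibre_sum[OF assms])
qed

section \<open>The performance cost of merging\<close>

lemma mixture_eq:
  fixes a b :: "'a::real_vector"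
  assumes "m + n \<noteq> 0"
  shows "(m *\<^sub>R a + n *\<^sub>R b) /\<^sub>R (m + n) = (m / (m + n)) *\<^sub>R a + (1 - m / (m + n)) *\<^sub>R b"
proof -
  have "1 - m / (m + n) = n / (m + n)" using assms by (simp add: field_simps)
  then show ?thesis by (simp add: scaleR_add_right divide_inverse mult.commute)
qed

text \<open>The cost estimate for one cell. The merged ratio is the average of the old ratios with
  weights \<open>m z + n z\<close>, so it stays between \<open>l\<close> and
  \<open>l + \<delta>\<close> and every old mixture is within the modulus of the merged one. The
  error is kept inside the sum so that the estimates for different cells add up.\<close>

lemma merged_cost_le:
  fixes a b :: "'a::real_vector" and h :: "'a \<Rightarrow> real"
  assumes "finite C" and nonneg: "\<And>z. z \<in> C \<Longrightarrow> m z \<ge> 0 \<and> n z \<ge> 0"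
    and range: "\<And>z. z \<in> C \<Longrightarrow> l \<le> m z / (m z + n z) \<and> m z / (m z + n z) \<le> l + \<delta>"
    and modulus: "\<And>s t. \<lbrakk>s \<in> {0..1}; t \<in> {0..1}; \<bar>s - t\<bar> \<le> \<delta>\<rbrakk>
      \<Longrightarrow> \<bar>h (s *\<^sub>R a + (1 - s) *\<^sub>R b) - h (t *\<^sub>R a + (1 - t) *\<^sub>R b)\<bar> < \<epsilon>"
  shows "(sum m C + sum n C) * h ((sum m C *\<^sub>R a + sum n C *\<^sub>R b) /\<^sub>R (sum m C + sum n C))
    \<le> (\<Sum>z\<in>C. (m z + n z) * h ((m z *\<^sub>R a + n z *\<^sub>R b) /\<^sub>R (m z + n z)) + \<epsilon> * (m z + n z))"
proof (cases "sum m C + sum n C = 0")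
  \<comment> \<open>All the weights in \<open>C\<close> vanish, so both sides are 0 whatever
    \<open>h\<close> is.\<close>
  case True
  then have "(\<Sum>z\<in>C. m z + n z) = 0" by (simp add: sum.distrib)
  then have "\<forall>z\<in>C. m z + n z = 0"
    using nonneg \<open>finite C\<close> by (subst (asm) sum_nonneg_eq_0_iff) auto
  with True show ?thesis by simp
next
  case False
  define M where "M = sum m C + sum n C"
  define t where "t = sum m C / M"
  have nn: "sum m C \<ge> 0" "sum n C \<ge> 0" using nonneg by (auto intro: sum_nonneg)
  with False have M: "M > 0" by (simp add: M_def)
  have t01: "t \<in> {0..1}" using nn M by (auto simp: t_def M_def)
  have M_sum: "M = (\<Sum>z\<in>C. m z + n z)" by (simp add: M_def sum.distrib)
  \<comment> \<open>Without denominators the bounds are additive and can be summed over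
    \<open>C\<close>. At a point of zero weight they read \<open>0 \<le> 0\<close>, since
    nonnegativity forces \<open>m z = 0\<close>.\<close>
  have between: "l * (m z + n z) \<le> m z \<and> m z \<le> (l + \<delta>) * (m z + n z)" if "z \<in> C" for z
    using range[OF that] nonneg[OF that] by (cases "m z + n z = 0") (auto simp: field_simps)
  have "l * M \<le> sum m C" "sum m C \<le> (l + \<delta>) * M"
    unfolding M_sum sum_distrib_left using between by (auto intro: sum_mono)
  with M have t: "l \<le> t" "t \<le> l + \<delta>" by (auto simp: t_def field_simps)
  have "M * h ((sum m C *\<^sub>R a + sum n C *\<^sub>R b) /\<^sub>R M) = M * h (t *\<^sub>R a + (1 - t) *\<^sub>R b)"
    by (simp only: M_def t_def mixture_eq[OF False])
  also have "\<dots> = (\<Sum>z\<in>C. (m z + n z) * h (t *\<^sub>R a + (1 - t) *\<^sub>R b))"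
    by (simp add: M_sum sum_distrib_right)
  also have "\<dots> \<le> (\<Sum>z\<in>C. (m z + n z) * h ((m z *\<^sub>R a + n z *\<^sub>R b) /\<^sub>R (m z + n z))
      + \<epsilon> * (m z + n z))"
  proof (rule sum_mono)
    fix z assume z: "z \<in> C"
    let ?s = "m z / (m z + n z)"
    show "(m z + n z) * h (t *\<^sub>R a + (1 - t) *\<^sub>R b)
        \<le> (m z + n z) * h ((m z *\<^sub>R a + n z *\<^sub>R b) /\<^sub>R (m z + n z)) + \<epsilon> * (m z + n z)"
    proof (cases "m z + n z = 0")
      case nz: False
      have "?s \<in> {0..1}" using nonneg[OF z] nz by auto
      then have "\<bar>h (t *\<^sub>R a + (1 - t) *\<^sub>R b) - h (?s *\<^sub>R a + (1 - ?s) *\<^sub>R b)\<bar> < \<epsilon>"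
        using t01 t range[OF z] by (intro modulus) auto
      then have "h (t *\<^sub>R a + (1 - t) *\<^sub>R b)
          \<le> h ((m z *\<^sub>R a + n z *\<^sub>R b) /\<^sub>R (m z + n z)) + \<epsilon>"
        by (simp add: mixture_eq[OF nz])
      then have "(m z + n z) * h (t *\<^sub>R a + (1 - t) *\<^sub>R b)
          \<le> (m z + n z) * (h ((m z *\<^sub>R a + n z *\<^sub>R b) /\<^sub>R (m z + n z)) + \<epsilon>)"
        using nonneg[OF z] by (intro mult_left_mono) auto
      then show ?thesis by (simp add: algebra_simps)
    qed simp
  qed
  finally show ?thesis by (simp add: M_def)
qed

text \<open>The number \<open>N\<close> is the mesh from \<open>mixture_modulus\<close>, fixed
  before the weights, proportions and distributions are given. The labelling \<open>c\<close>
  records the cell of length \<open>1 / N\<close> that contains the mixture parameter.\<close>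

lemma bounded_merging:
  fixes h :: "real ^ 'y \<Rightarrow> real"
  assumes "continuous_on prob_simplex h" "\<epsilon> > 0"
  obtains N :: nat where "\<And>\<alpha>0 \<alpha>1 \<rho>u \<rho>v (Z :: 'z set) p q.
    \<lbrakk>finite Z; 0 \<le> \<alpha>0; 0 \<le> \<alpha>1; \<rho>u \<in> prob_simplex; \<rho>v \<in> prob_simplex;
     \<And>z. z \<in> Z \<Longrightarrow> 0 \<le> p z; \<And>z. z \<in> Z \<Longrightarrow> 0 \<le> q z\<rbrakk>
    \<Longrightarrow> \<exists>c :: 'z \<Rightarrow> nat. c ` Z \<subseteq> {..N} \<and>
      perf_cost h \<alpha>0 \<alpha>1 \<rho>u \<rho>v (c ` Z) (fibre_sum Z c p) (fibre_sum Z c q)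
      \<le> perf_cost h \<alpha>0 \<alpha>1 \<rho>u \<rho>v Z p q + \<epsilon> * (\<alpha>0 * total_weight Z p + \<alpha>1 * total_weight Z q)"
proof -
  obtain N :: nat where N: "N > 0" and modulus:
    "\<And>a b s t. \<lbrakk>a \<in> prob_simplex; b \<in> prob_simplex; s \<in> {0..1}; t \<in> {0..1}; \<bar>s - t\<bar> \<le> 1 / N\<rbrakk>
      \<Longrightarrow> \<bar>h (s *\<^sub>R a + (1 - s) *\<^sub>R b) - h (t *\<^sub>R a + (1 - t) *\<^sub>R b)\<bar> < \<epsilon>"
    using mixture_modulus[OF compact_prob_simplex convex_prob_simplex assms] by metis
  show ?thesis
  proof (rule that[of N])
    fix \<alpha>0 \<alpha>1 :: real and \<rho>u \<rho>v :: "real ^ 'y" and Z :: "'z set" and p q :: "'z \<Rightarrow> real"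
    assume Z: "finite Z" and \<alpha>: "0 \<le> \<alpha>0" "0 \<le> \<alpha>1"
      and \<rho>: "\<rho>u \<in> prob_simplex" "\<rho>v \<in> prob_simplex"
      and p: "\<And>z. z \<in> Z \<Longrightarrow> 0 \<le> p z" and q: "\<And>z. z \<in> Z \<Longrightarrow> 0 \<le> q z"
    define m n where "m = (\<lambda>z. \<alpha>0 * p z)" and "n = (\<lambda>z. \<alpha>1 * q z)"
    define t where "t = (\<lambda>z. m z / (m z + n z))"
    \<comment> \<open>The parameter 1 alone receives the label \<open>N\<close>, so the labels are 0
      to \<open>N\<close>, which is \<open>N + 1\<close> values. Points of zero weight have
      \<open>t z = 0\<close> by the convention for division by 0 and fall into cell 0.\<close>
    define c where "c = (\<lambda>z. nat \<lfloor>N * t z\<rfloor>)"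
    define e where "e = (\<lambda>z. (m z + n z) * h ((m z *\<^sub>R \<rho>u + n z *\<^sub>R \<rho>v) /\<^sub>R (m z + n z)))"
    have mn: "m z \<ge> 0 \<and> n z \<ge> 0" if "z \<in> Z" for z
      using that \<alpha> p q by (simp add: m_def n_def)
    have t01: "t z \<ge> 0 \<and> t z \<le> 1" if "z \<in> Z" for z
      using mn[OF that] by (auto simp: t_def divide_le_eq_1)
    have cell: "real (c z) / N \<le> t z \<and> t z \<le> real (c z) / N + 1 / N" if "z \<in> Z" for z
    proof -
      have "real (c z) = of_int \<lfloor>N * t z\<rfloor>" using t01[OF that] by (simp add: c_def)
      then have "real (c z) \<le> N * t z" "N * t z \<le> real (c z) + 1" by linarith+
      then show ?thesis using N by (simp add: field_simps)
    qed
    have "c z \<le> N" if "z \<in> Z" for z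
    proof -
      have "N * t z \<le> N" using t01[OF that] by (simp add: mult_left_le)
      then show ?thesis unfolding c_def by linarith
    qed
    then have range: "c ` Z \<subseteq> {..N}" by auto
    \<comment> \<open>Each label is estimated separately by a fibre sum, and
      \<open>sum_fibre_sum\<close> then turns the total back into a sum over
      \<open>Z\<close>.\<close>
    have "perf_cost h \<alpha>0 \<alpha>1 \<rho>u \<rho>v (c ` Z) (fibre_sum Z c p) (fibre_sum Z c q)
        \<le> (\<Sum>k\<in>c ` Z. fibre_sum Z c (\<lambda>z. e z + \<epsilon> * (m z + n z)) k)"
      unfolding perf_cost_def
    proof (rule sum_mono)
      fix k
      let ?C = "{z. z \<in> Z \<and> c z = k}"
      have eq: "\<alpha>0 * fibre_sum Z c p k = sum m ?C" "\<alpha>1 * fibre_sum Z c q k = sum n ?C"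
        by (simp_all add: fibre_sum_def m_def n_def sum_distrib_left)
      show "(\<alpha>0 * fibre_sum Z c p k + \<alpha>1 * fibre_sum Z c q k) *
          h (((\<alpha>0 * fibre_sum Z c p k) *\<^sub>R \<rho>u + (\<alpha>1 * fibre_sum Z c q k) *\<^sub>R \<rho>v) /\<^sub>R
             (\<alpha>0 * fibre_sum Z c p k + \<alpha>1 * fibre_sum Z c q k))
          \<le> fibre_sum Z c (\<lambda>z. e z + \<epsilon> * (m z + n z)) k"
        unfolding eq unfolding fibre_sum_def e_def
      proof (rule merged_cost_le)
        show "real k / N \<le> m z / (m z + n z) \<and> m z / (m z + n z) \<le> real k / N + 1 / N"
          if "z \<in> ?C" for z
          using cell[of z] that by (auto simp: t_def)
      qed (use Z mn modulus \<rho> in auto)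
    qed
    also have "\<dots> = (\<Sum>z\<in>Z. e z + \<epsilon> * (m z + n z))" by (rule sum_fibre_sum[OF Z])
    also have "\<dots> = perf_cost h \<alpha>0 \<alpha>1 \<rho>u \<rho>v Z p q
        + \<epsilon> * (\<alpha>0 * total_weight Z p + \<alpha>1 * total_weight Z q)"
      by (simp add: perf_cost_def total_weight_def e_def m_def n_def sum.distrib sum_distrib_left
          distrib_left)
    finally show "\<exists>c :: 'z \<Rightarrow> nat. c ` Z \<subseteq> {..N} \<and>
      perf_cost h \<alpha>0 \<alpha>1 \<rho>u \<rho>v (c ` Z) (fibre_sum Z c p) (fibre_sum Z c q)
      \<le> perf_cost h \<alpha>0 \<alpha>1 \<rho>u \<rho>v Z p q + \<epsilon> * (\<alpha>0 * total_weight Z p + \<alpha>1 * total_weight Z q)"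
      using range by blast
  qed
qed

section \<open>Realising prescribed weights by an invertible representation\<close>

text \<open>The missing mass \<open>1 - sum a Z\<close> is placed at the fresh point
  \<open>x\<close>.\<close>

lemma pmf_completion:
  assumes "finite Z" "\<And>z. z \<in> Z \<Longrightarrow> a z \<ge> 0" "sum a Z \<le> (1::real)" "x \<notin> Z"
  obtains P where "\<And>z. z \<in> Z \<Longrightarrow> pmf P z = a z" "set_pmf P \<subseteq> insert x Z"
proof -
  define f where "f z = (if z \<in> Z then a z else if z = x then 1 - sum a Z else 0)" for z
  have nonneg: "f z \<ge> 0" for z using assms by (simp add: f_def)
  have "(\<integral>\<^sup>+z. ennreal (f z) \<partial>count_space UNIV) = (\<Sum>z\<in>insert x Z. ennreal (f z))"
    using assms(1) by (intro nn_integral_count_space') (auto simp: f_def)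
  also have "\<dots> = ennreal (\<Sum>z\<in>insert x Z. f z)" using nonneg by (simp add: sum_ennreal)
  also have "(\<Sum>z\<in>insert x Z. f z) = 1"
    using assms(1,4) by (simp add: f_def)
  finally have prob: "(\<integral>\<^sup>+z. ennreal (f z) \<partial>count_space UNIV) = 1" by simp
  have P: "pmf (embed_pmf f) z = f z" for z by (rule pmf_embed_pmf[OF nonneg prob])
  show ?thesis
  proof (rule that[of "embed_pmf f"])
    show "pmf (embed_pmf f) z = a z" if "z \<in> Z" for z using that by (simp add: P f_def)
    show "set_pmf (embed_pmf f) \<subseteq> insert x Z"
      by (auto simp: set_pmf_iff P f_def split: if_splits)
  qed
qed

(* Each point s sends the weight not used on Z' to a private point M + s beyond Z'; privacy makes
   the representation invertible because the groups are disjoint. *)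
lemma two_point_representation_realise:
  assumes model: "data_model S0 S1 \<zeta> \<rho>" and u: "u \<in> S0" and v: "v \<in> (S1 :: nat set)"
    and Z: "finite (Z :: nat set)"
    and a: "\<And>z. z \<in> Z \<Longrightarrow> a z > 0" "sum a Z \<le> 1" and b: "\<And>z. z \<in> Z \<Longrightarrow> b z > 0" "sum b Z \<le> 1"
  shows "two_point_representation (group_proportion \<zeta> S0) (group_proportion \<zeta> S1) (\<rho> u) (\<rho> v) Z
    (\<lambda>z. group_weight \<zeta> S0 u * a z) (\<lambda>z. group_weight \<zeta> S1 v * b z)"
proof -
  obtain M where M: "\<And>z. z \<in> Z \<Longrightarrow> z < M" using Z unfolding finite_nat_set_iff_bounded by auto
  have fin: "finite S0" "finite S1" and disj: "S0 \<inter> S1 = {}" using model by (auto simp: data_model_def)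
  then have "u \<noteq> v" using u v by auto
  have new: "M + s \<notin> Z" for s using M[of "M + s"] by auto
  obtain P where P: "\<And>z. z \<in> Z \<Longrightarrow> pmf P z = a z" "set_pmf P \<subseteq> insert (M + u) Z"
    using pmf_completion[of Z a "M + u"] Z a new by (metis less_imp_le)
  obtain Q where Q: "\<And>z. z \<in> Z \<Longrightarrow> pmf Q z = b z" "set_pmf Q \<subseteq> insert (M + v) Z"
    using pmf_completion[of Z b "M + v"] Z b new by (metis less_imp_le)
  define T0 where "T0 s = (if s = u then P else return_pmf (M + s))" for s
  define T1 where "T1 s = (if s = v then Q else return_pmf (M + s))" for s
  define W where "W = Z \<union> (\<lambda>s. M + s) ` (S0 \<union> S1)"
  \<comment> \<open>This dichotomy gives invertibility: a point \<open>M + s\<close> beyond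
    \<open>Z\<close> determines \<open>s\<close>, and a point of \<open>Z\<close> can have no parent
    but \<open>u\<close> in the first group. The fact \<open>T1\<close> does the same for
    \<open>v\<close>.\<close>
  have T0: "z = M + s \<or> z \<in> Z \<and> s = u" if "pmf (T0 s) z > 0" for s z
    using that P(2) by (auto simp: T0_def pmf_positive_iff set_pmf_iff indicator_def split: if_splits)
  have T1: "z = M + s \<or> z \<in> Z \<and> s = v" if "pmf (T1 s) z > 0" for s z
    using that Q(2) by (auto simp: T1_def pmf_positive_iff set_pmf_iff indicator_def split: if_splits)
  have "invertible_representation S0 S1 W T0 T1"
    unfolding invertible_representation_def representation_def
  proof (intro conjI ballI allI impI)
    show "finite W" using Z fin by (simp add: W_def)
    show "set_pmf (T0 s) \<subseteq> W" if "s \<in> S0" for s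
      using that T0[of s] by (auto simp: W_def pmf_positive_iff)
    show "set_pmf (T1 s) \<subseteq> W" if "s \<in> S1" for s
      using that T1[of s] by (auto simp: W_def pmf_positive_iff)
    show "s = s'" if "is_parent S0 T0 s z \<and> is_parent S0 T0 s' z" for s s' z
      using that T0[of s z] T0[of s' z] new by (auto simp: is_parent_def)
    show "s = s'" if "is_parent S1 T1 s z \<and> is_parent S1 T1 s' z" for s s' z
      using that T1[of s z] T1[of s' z] new by (auto simp: is_parent_def)
  qed
  moreover have "Z = {z \<in> W. is_parent S0 T0 u z \<and> is_parent S1 T1 v z}"
  proof (intro equalityI subsetI)
    fix z assume "z \<in> Z"
    then show "z \<in> {z \<in> W. is_parent S0 T0 u z \<and> is_parent S1 T1 v z}"
      using u v a b by (simp add: W_def is_parent_def T0_def T1_def P Q)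
  next
    \<comment> \<open>A common child of \<open>u\<close> and \<open>v\<close> outside
      \<open>Z\<close> would equal both \<open>M + u\<close> and \<open>M + v\<close>, contradicting
      \<open>u \<noteq> v\<close>.\<close>
    fix z assume "z \<in> {z \<in> W. is_parent S0 T0 u z \<and> is_parent S1 T1 v z}"
    then show "z \<in> Z"
      using T0[of u z] T1[of v z] \<open>u \<noteq> v\<close> by (auto simp: is_parent_def)
  qed
  moreover have "\<forall>z\<in>Z. group_weight \<zeta> S0 u * a z = group_weight \<zeta> S0 u * pmf (T0 u) z \<and>
      group_weight \<zeta> S1 v * b z = group_weight \<zeta> S1 v * pmf (T1 v) z"
    by (simp add: T0_def T1_def P Q)
  ultimately show ?thesis
    unfolding two_point_representation_def using model u v by blast
qed

section \<open>Merging as an operation on two-point representations\<close>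

lemma sum_pmf_le_1: "finite Z \<Longrightarrow> sum (pmf P) Z \<le> 1"
  by (simp flip: measure_measure_pmf_finite)

text \<open>Merged weights keep the form of group weight times kernel value. Merging the kernel
  values themselves avoids a division by \<open>g\<close>, which may be 0.\<close>

lemma fibre_sum_scale:
  assumes "\<And>z. z \<in> Z \<Longrightarrow> p z = g * a z"
  shows "fibre_sum Z c p = (\<lambda>k. g * fibre_sum Z c a k)"
  using assms by (auto simp: fibre_sum_def sum_distrib_left)

theorem lemmaD1:
  fixes h :: "real ^ 'y \<Rightarrow> real" and \<epsilon> :: real
  assumes "continuous_on prob_simplex h"
    and "concave_on prob_simplex h"
    and "\<epsilon> > 0"
  shows "\<exists>n :: nat. \<forall>\<alpha>0 \<alpha>1 \<rho>u \<rho>v (Z :: nat set) p q.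
           two_point_representation \<alpha>0 \<alpha>1 \<rho>u \<rho>v Z p q \<longrightarrow>
           (\<exists>(Z' :: nat set) p' q'.
              two_point_representation \<alpha>0 \<alpha>1 \<rho>u \<rho>v Z' p' q' \<and>
              total_weight Z' p' = total_weight Z p \<and>
              total_weight Z' q' = total_weight Z q \<and>
              card Z' \<le> n \<and>
              fairness Z' p' q' \<le> fairness Z p q \<and>
              perf_cost h \<alpha>0 \<alpha>1 \<rho>u \<rho>v Z' p' q' \<le>
                perf_cost h \<alpha>0 \<alpha>1 \<rho>u \<rho>v Z p q
                + 2 * (total_weight Z p + total_weight Z q) * \<epsilon>)"
proof -
  obtain N :: nat where N: "\<And>\<alpha>0 \<alpha>1 \<rho>u \<rho>v (Z :: nat set) p q.
    \<lbrakk>finite Z; 0 \<le> \<alpha>0; 0 \<le> \<alpha>1; \<rho>u \<in> prob_simplex; \<rho>v \<in> prob_simplex;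
     \<And>z. z \<in> Z \<Longrightarrow> 0 \<le> p z; \<And>z. z \<in> Z \<Longrightarrow> 0 \<le> q z\<rbrakk>
    \<Longrightarrow> \<exists>c :: nat \<Rightarrow> nat. c ` Z \<subseteq> {..N} \<and>
      perf_cost h \<alpha>0 \<alpha>1 \<rho>u \<rho>v (c ` Z) (fibre_sum Z c p) (fibre_sum Z c q)
      \<le> perf_cost h \<alpha>0 \<alpha>1 \<rho>u \<rho>v Z p q + \<epsilon> * (\<alpha>0 * total_weight Z p + \<alpha>1 * total_weight Z q)"
    using bounded_merging[OF assms(1,3)] by blast
  show ?thesis
  \<comment> \<open>\<open>Suc N\<close> is the number of labels in \<open>{..N}\<close>.\<close>
  proof (intro exI[of _ "Suc N"] allI impI)
    fix \<alpha>0 \<alpha>1 :: real and \<rho>u \<rho>v :: "real ^ 'y" and Z :: "nat set" and p q :: "nat \<Rightarrow> real"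
    assume "two_point_representation \<alpha>0 \<alpha>1 \<rho>u \<rho>v Z p q"
    then obtain S0 S1 :: "nat set" and \<zeta> \<rho> W T0 T1 u v where model: "data_model S0 S1 \<zeta> \<rho>"
      and inv: "invertible_representation S0 S1 W T0 T1" and uv: "u \<in> S0" "v \<in> S1"
      and \<alpha>: "\<alpha>0 = group_proportion \<zeta> S0" "\<alpha>1 = group_proportion \<zeta> S1"
      and \<rho>: "\<rho>u = \<rho> u" "\<rho>v = \<rho> v"
      and Z: "Z = {z \<in> W. is_parent S0 T0 u z \<and> is_parent S1 T1 v z}"
      and pq: "\<And>z. z \<in> Z \<Longrightarrow> p z = group_weight \<zeta> S0 u * pmf (T0 u) z"
        "\<And>z. z \<in> Z \<Longrightarrow> q z = group_weight \<zeta> S1 v * pmf (T1 v) z"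
      unfolding two_point_representation_def by blast
    have fin: "finite Z"
      using inv Z by (simp add: invertible_representation_def representation_def)
    have pos: "pmf (T0 u) z > 0" "pmf (T1 v) z > 0" if "z \<in> Z" for z
      using that Z by (simp_all add: is_parent_def)
    have gw: "group_weight \<zeta> S0 u \<ge> 0" "group_weight \<zeta> S1 v \<ge> 0"
      by (simp_all add: group_weight_def cond_prob_def)
    have nonneg: "p z \<ge> 0" "q z \<ge> 0" if "z \<in> Z" for z
      using pq[OF that] gw by simp_all
    have \<alpha>01: "0 \<le> \<alpha>0" "\<alpha>0 \<le> 1" "0 \<le> \<alpha>1" "\<alpha>1 \<le> 1"
      by (simp_all add: \<alpha> group_proportion_def)
    have simplex: "\<rho>u \<in> prob_simplex" "\<rho>v \<in> prob_simplex"
      using model uv by (auto simp: \<rho> data_model_def)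
    obtain c :: "nat \<Rightarrow> nat" where range: "c ` Z \<subseteq> {..N}" and cost:
      "perf_cost h \<alpha>0 \<alpha>1 \<rho>u \<rho>v (c ` Z) (fibre_sum Z c p) (fibre_sum Z c q)
       \<le> perf_cost h \<alpha>0 \<alpha>1 \<rho>u \<rho>v Z p q + \<epsilon> * (\<alpha>0 * total_weight Z p + \<alpha>1 * total_weight Z q)"
      using N[of Z \<alpha>0 \<alpha>1 \<rho>u \<rho>v p q] fin \<alpha>01(1,3) simplex nonneg by blast
    have scale: "fibre_sum Z c p = (\<lambda>k. group_weight \<zeta> S0 u * fibre_sum Z c (pmf (T0 u)) k)"
      "fibre_sum Z c q = (\<lambda>k. group_weight \<zeta> S1 v * fibre_sum Z c (pmf (T1 v)) k)"
      by (rule fibre_sum_scale, erule pq)+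
    have "two_point_representation \<alpha>0 \<alpha>1 \<rho>u \<rho>v (c ` Z) (fibre_sum Z c p) (fibre_sum Z c q)"
      unfolding scale \<alpha> \<rho>
      by (rule two_point_representation_realise[OF model uv])
        (use fin pos in \<open>auto intro!: fibre_sum_pos simp: sum_fibre_sum sum_pmf_le_1\<close>)
    moreover have "total_weight (c ` Z) (fibre_sum Z c p) = total_weight Z p"
      "total_weight (c ` Z) (fibre_sum Z c q) = total_weight Z q"
      by (simp_all add: total_weight_def sum_fibre_sum fin)
    moreover have "card (c ` Z) \<le> Suc N" using card_mono[OF _ range] by simp
    moreover have "fairness (c ` Z) (fibre_sum Z c p) (fibre_sum Z c q) \<le> fairness Z p q"
      by (rule fairness_fibre_sum_le[OF fin])
    moreover have "perf_cost h \<alpha>0 \<alpha>1 \<rho>u \<rho>v (c ` Z) (fibre_sum Z c p) (fibre_sum Z c q)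
        \<le> perf_cost h \<alpha>0 \<alpha>1 \<rho>u \<rho>v Z p q + 2 * (total_weight Z p + total_weight Z q) * \<epsilon>"
    \<comment> \<open>As \<alpha>0 and \<alpha>1 are at most 1 and the total weights are
      nonnegative, the error is at most \<epsilon> times the sum of the total weights, which lies
      within the claimed bound.\<close>
    proof -
      have w: "total_weight Z p \<ge> 0" "total_weight Z q \<ge> 0"
        using nonneg by (auto simp: total_weight_def intro: sum_nonneg)
      then have "\<alpha>0 * total_weight Z p + \<alpha>1 * total_weight Z q \<le> 2 * (total_weight Z p + total_weight Z q)"
        using mult_right_mono[OF \<alpha>01(2) w(1)] mult_right_mono[OF \<alpha>01(4) w(2)] by simp
      then have "\<epsilon> * (\<alpha>0 * total_weight Z p + \<alpha>1 * total_weight Z q)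
          \<le> \<epsilon> * (2 * (total_weight Z p + total_weight Z q))"
        using \<open>\<epsilon> > 0\<close> by (intro mult_left_mono) auto
      with cost show ?thesis by (simp only: mult.commute[of _ \<epsilon>])
    qed
    ultimately show "\<exists>(Z' :: nat set) p' q'.
              two_point_representation \<alpha>0 \<alpha>1 \<rho>u \<rho>v Z' p' q' \<and>
              total_weight Z' p' = total_weight Z p \<and>
              total_weight Z' q' = total_weight Z q \<and>
              card Z' \<le> Suc N \<and>
              fairness Z' p' q' \<le> fairness Z p q \<and>
              perf_cost h \<alpha>0 \<alpha>1 \<rho>u \<rho>v Z' p' q' \<le>
                perf_cost h \<alpha>0 \<alpha>1 \<rho>u \<rho>v Z p q
                + 2 * (total_weight Z p + total_weight Z q) * \<epsilon>"
      by blast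
  qed
qed

end
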